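(* Let $p$ be a prime and let $q\in\mathbb{C}_p$ with $q\neq 1$ and $|1-q|_p<p^{-1/(p-1)}$. Let $m\ge 0$ be an integer, let $n\in\mathbb{N}$ be a positive integer, let $w_1,\dots,w_n\in\mathbb{N}$ be positive integers, and let $x\in\mathbb{Z}_p$. For $\sigma\in S_n$ define $$B_\sigma=\left[\prod_{j=1}^{n-1}w_{\sigma(j)}\right]_q^{m-1}\sum_{k_1=0}^{w_{\sigma(1)}-1}\cdots\sum_{k_{n-1}=0}^{w_{\sigma(n-1)}-1} q^{\,w_{\sigma(n)}\sum_{j=1}^{n-1}\left(\prod_{1\le i\le n-1,\, i\ne j}w_{\sigma(i)}\right)k_j}$$ $$\times\ \beta_{m,\,q^{w_{\sigma(1)}\cdots w_{\sigma(n-1)}}}\!\left(w_{\sigma(n)}x+w_{\sigma(n)}\sum_{j=1}^{n-1}\frac{k_j}{w_{\sigma(j)}}\right),$$ where $\beta_{m,Q}(\cdot)$ denotes the $m$-th Carlitz $Q$-Bernoulli polynomial. Then $B_\sigma$ is the same for all $\sigma\in S_n$; that is, $B_\sigma=B_\tau$ for all $\sigma,\tau\in S_n$.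
   Context: $\mathbb{Z}_p$ is the ring of $p$-adic integers and $\mathbb{C}_p$ is the completion of an algebraic closure of $\mathbb{Q}_p$, with the $p$-adic norm normalized by $|p|_p=1/p$. $S_n$ is the symmetric group on $\{1,\dots,n\}$. For $Q\in\mathbb{C}_p$ with $Q\ne1$, $|1-Q|_p<p^{-1/(p-1)}$, and $z\in\mathbb{Q}_p$ such that $|z\log Q|_p<p^{-1/(p-1)}$ (in particular for $z\in\mathbb{Z}_p$), put $Q^z=\exp(z\log Q)$ ($p$-adic exponential and logarithm) and $[z]_Q=\frac{1-Q^z}{1-Q}$. Every power $Q=q^w$ with $w$ a positive integer and $q$ as in the claim again satisfies $Q\neq1$ and $|1-Q|_p<p^{-1/(p-1)}$. If $Q=q^{W}$ with $W=w_{\sigma(1)}\cdots w_{\sigma(n-1)}$ and $a$ is one of the arguments of $\beta_{m,Q}$ in the claim, then $Wa\in\mathbb{Z}_p$ and $Q^{a}=q^{Wa}$ is well defined. Carlitz $Q$-Bernoulli numbers $\beta_{l,Q}$ ($l\ge0$) are defined recursively by $\beta_{0,Q}=1$ and, for $r\ge1$, $$Q\sum_{l=0}^{r}\binom{r}{l}Q^{l}\beta_{l,Q}-\beta_{r,Q}=\begin{cases}1&\text{if } r=1,\\ 0&\text{if } r>1.\end{cases}$$ Carlitz $Q$-Bernoulli polynomials are $$\beta_{m,Q}(a)=\sum_{l=0}^{m}\binom{m}{l}Q^{la}[a]_Q^{m-l}\beta_{l,Q}\qquad(m\ge0),$$ with $0^0=1$, where $Q^{la}=(Q^a)^l$. Empty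 products equal $1$ and empty sums in exponents or arguments equal $0$; when $n=1$ the multiple sum over $k_1,\dots,k_{n-1}$ consists of a single term. *)

theory Defs
  imports
    "HOL-Analysis.Analysis"
    "HOL-Computational_Algebra.Polynomial"
    "HOL-Computational_Algebra.Primes"
    "HOL-Combinatorics.Permutations"
begin

text \<open>
  Fields with a multiplicative non-archimedean absolute value, which induces the metric. The
  library class \<^class>\<open>real_normed_field\<close> is of no use here, since it forces the field to be an
  algebra over the reals; the library constant \<^const>\<open>norm\<close> is restricted to real vector spaces.
\<close>

class ultrametric_field = field_char_0 + metric_space +
  fixes abs_val :: "'a \<Rightarrow> real"
  assumes dist_abs_val: "dist x y = abs_val (x - y)"
    and abs_val_mult: "abs_val (x * y) = abs_val x * abs_val y"
    and abs_val_add: "abs_val (x + y) \<le> max (abs_val x) (abs_val y)"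

text \<open>
  Inside a complete ultrametric field with \<open>abs_val p = 1 / p\<close>, the closure of the rationals is
  \<open>\<rat>\<^sub>p\<close>: the absolute value restricts to the \<open>p\<close>-adic absolute value on the rationals, and a closed
  subset of a complete space is complete.
\<close>

definition padic_rationals :: "'a::ultrametric_field set" where
  "padic_rationals = closure \<rat>"

definition padic_integers :: "'a::ultrametric_field set" where
  "padic_integers = {x \<in> padic_rationals. abs_val x \<le> 1}"

definition algebraic_over :: "'a::field set \<Rightarrow> 'a \<Rightarrow> bool" where
  "algebraic_over K x \<longleftrightarrow> (\<exists>f. f \<noteq> 0 \<and> (\<forall>i. coeff f i \<in> K) \<and> poly f x = 0)"

definition algebraically_closed_subfield :: "'a::field set \<Rightarrow> bool" where
  "algebraically_closed_subfield K \<longleftrightarrow>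
     (\<forall>f. degree f > 0 \<and> (\<forall>i. coeff f i \<in> K) \<longrightarrow> (\<exists>x\<in>K. poly f x = 0))"

definition padic_algebraic_numbers :: "'a::ultrametric_field set" where
  "padic_algebraic_numbers = {x. algebraic_over padic_rationals x}"

text \<open>
  The type \<open>'a\<close>, with its absolute value, is a completion of an algebraic closure of \<open>\<rat>\<^sub>p\<close>, normalized by
  \<open>abs_val p = 1 / p\<close>. This determines \<open>\<complex>\<^sub>p\<close> up to isometric isomorphism of fields: the elements
  algebraic over \<open>\<rat>\<^sub>p\<close> form an algebraic closure of \<open>\<rat>\<^sub>p\<close>, the extension of the absolute
  value to it is unique, and \<open>'a\<close> is complete and contains it as a dense subfield.
\<close>

definition padic_complex_field :: "nat \<Rightarrow> 'a::ultrametric_field itself \<Rightarrow> bool" where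
  "padic_complex_field p T \<longleftrightarrow>
     abs_val (of_nat p :: 'a) = 1 / real p \<and>
     complete (UNIV :: 'a set) \<and>
     algebraically_closed_subfield (padic_algebraic_numbers :: 'a set) \<and>
     closure (padic_algebraic_numbers :: 'a set) = UNIV"

definition padic_exp :: "'a::ultrametric_field \<Rightarrow> 'a" where
  "padic_exp z = (\<Sum>k. z ^ k / fact k)"

definition padic_log :: "'a::ultrametric_field \<Rightarrow> 'a" where
  "padic_log Q = (\<Sum>k. (-1) ^ k * (Q - 1) ^ Suc k / of_nat (Suc k))"

text \<open>
  The next two notions are meaningful for \<open>Q \<noteq> 1\<close>, \<open>abs_val (1 - Q) < p powr (-1 / (p - 1))\<close> and
  \<open>z\<close> in \<open>\<rat>\<^sub>p\<close> with \<open>abs_val (z * padic_log Q) < p powr (-1 / (p - 1))\<close>.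
\<close>

definition padic_power :: "'a::ultrametric_field \<Rightarrow> 'a \<Rightarrow> 'a" where
  "padic_power Q z = padic_exp (z * padic_log Q)"

definition q_number :: "'a::ultrametric_field \<Rightarrow> 'a \<Rightarrow> 'a" where
  "q_number Q z = (1 - padic_power Q z) / (1 - Q)"

definition carlitz_recursion :: "'a::field_char_0 \<Rightarrow> (nat \<Rightarrow> 'a) \<Rightarrow> bool" where
  "carlitz_recursion Q b \<longleftrightarrow>
     b 0 = 1 \<and>
     (\<forall>r\<ge>1. Q * (\<Sum>l\<le>r. of_nat (r choose l) * Q ^ l * b l) - b r = (if r = 1 then 1 else 0))"

definition carlitz_number :: "'a::field_char_0 \<Rightarrow> nat \<Rightarrow> 'a" where
  "carlitz_number Q = (THE b. carlitz_recursion Q b)"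

text \<open>
  The coefficient of \<open>b r\<close> in the \<open>r\<close>-th equation is \<open>Q ^ (r + 1) - 1\<close>, so the recursion has
  exactly one solution unless \<open>Q\<close> is a root of unity. In \<open>\<complex>\<^sub>p\<close> no \<open>Q \<noteq> 1\<close> with
  \<open>abs_val (1 - Q) < p powr (-1 / (p - 1))\<close> is a root of unity.
\<close>

lemma carlitz_recursion_step:
  fixes Q :: "'a::field_char_0"
  shows "Q * (\<Sum>l\<le>r. of_nat (r choose l) * Q ^ l * b l) - b r =
    Q * (\<Sum>l<r. of_nat (r choose l) * Q ^ l * b l) + (Q ^ Suc r - 1) * b r"
  by (simp add: lessThan_Suc_atMost[symmetric] algebra_simps)

fun carlitz_solution :: "'a::field_char_0 \<Rightarrow> nat \<Rightarrow> 'a" where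
  "carlitz_solution Q r = (if r = 0 then 1 else
     ((if r = 1 then 1 else 0) - Q * (\<Sum>l<r. of_nat (r choose l) * Q ^ l * carlitz_solution Q l))
       / (Q ^ Suc r - 1))"

declare carlitz_solution.simps [simp del]

lemma carlitz_recursion_ex1:
  fixes Q :: "'a::field_char_0"
  assumes nz: "\<And>r. r \<ge> 1 \<Longrightarrow> Q ^ Suc r \<noteq> 1"
  shows "\<exists>!b. carlitz_recursion Q b"
proof
  show "carlitz_recursion Q (carlitz_solution Q)"
    unfolding carlitz_recursion_def carlitz_recursion_step
  proof (intro conjI allI impI)
    show "carlitz_solution Q 0 = 1" by (simp add: carlitz_solution.simps)
  next
    fix r :: nat assume r: "r \<ge> 1"
    with nz[OF r] show "Q * (\<Sum>l<r. of_nat (r choose l) * Q ^ l * carlitz_solution Q l)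
        + (Q ^ Suc r - 1) * carlitz_solution Q r = (if r = 1 then 1 else 0)"
      by (subst (2) carlitz_solution.simps) (simp del: power_Suc)
  qed
next
  fix b assume b: "carlitz_recursion Q b"
  have "b r = carlitz_solution Q r" for r
  proof (induction r rule: less_induct)
    case (less r)
    show ?case
    proof (cases "r = 0")
      case True
      with b show ?thesis by (simp add: carlitz_recursion_def carlitz_solution.simps)
    next
      case False
      hence r: "r \<ge> 1" by simp
      have "Q * (\<Sum>l<r. of_nat (r choose l) * Q ^ l * b l) + (Q ^ Suc r - 1) * b r
          = (if r = 1 then 1 else 0)"
        using b r unfolding carlitz_recursion_def carlitz_recursion_step by blast
      hence "(Q ^ Suc r - 1) * b r = (if r = 1 then 1 else 0)
          - Q * (\<Sum>l<r. of_nat (r choose l) * Q ^ l * carlitz_solution Q l)"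
        using less by (simp add: algebra_simps del: power_Suc)
      hence "b r = ((if r = 1 then 1 else 0)
          - Q * (\<Sum>l<r. of_nat (r choose l) * Q ^ l * carlitz_solution Q l)) / (Q ^ Suc r - 1)"
        using nz[OF r] by (simp add: eq_divide_eq mult.commute del: power_Suc)
      thus ?thesis using False by (subst carlitz_solution.simps) simp
    qed
  qed
  thus "b = carlitz_solution Q" by blast
qed

lemma carlitz_recursion_carlitz_number:
  fixes Q :: "'a::field_char_0"
  assumes "\<And>r. r \<ge> 1 \<Longrightarrow> Q ^ Suc r \<noteq> 1"
  shows "carlitz_recursion Q (carlitz_number Q)"
  unfolding carlitz_number_def by (rule theI'[OF carlitz_recursion_ex1[OF assms]])

definition carlitz_poly :: "nat \<Rightarrow> 'a::ultrametric_field \<Rightarrow> 'a \<Rightarrow> 'a" where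
  "carlitz_poly m Q a =
     (\<Sum>l\<le>m. of_nat (m choose l) * padic_power Q a ^ l * q_number Q a ^ (m - l) * carlitz_number Q l)"

text \<open>
  The expression \<open>B\<^sub>\<sigma>\<close>. The indices \<open>1, \<dots>, n - 1\<close> form the set \<open>{1..<n}\<close>, and the multiple sum
  runs over all tuples \<open>(k\<^sub>1, \<dots>, k\<^sub>n\<^sub>-\<^sub>1)\<close>, encoded as extensional functions on \<open>{1..<n}\<close>. The
  outer exponent \<open>m - 1\<close> is an integer, equal to \<open>-1\<close> for \<open>m = 0\<close>.
\<close>

definition carlitz_B ::
  "nat \<Rightarrow> nat \<Rightarrow> (nat \<Rightarrow> nat) \<Rightarrow> 'a::ultrametric_field \<Rightarrow> 'a \<Rightarrow> (nat \<Rightarrow> nat) \<Rightarrow> 'a" where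
  "carlitz_B m n w q x \<sigma> =
     q_number q (of_nat (\<Prod>j\<in>{1..<n}. w (\<sigma> j))) powi (int m - 1) *
     (\<Sum>k \<in> (\<Pi>\<^sub>E j\<in>{1..<n}. {0..<w (\<sigma> j)}).
        q ^ (w (\<sigma> n) * (\<Sum>j\<in>{1..<n}. (\<Prod>i\<in>{1..<n} - {j}. w (\<sigma> i)) * k j)) *
        carlitz_poly m (q ^ (\<Prod>j\<in>{1..<n}. w (\<sigma> j)))
          (of_nat (w (\<sigma> n)) * x +
           of_nat (w (\<sigma> n)) * (\<Sum>j\<in>{1..<n}. of_nat (k j) / of_nat (w (\<sigma> j)))))"

end

theory Submission
  imports Defs
begin

text \<open>
  Writing \<open>Q\<^sup>a = exp (a log Q)\<close>, the Carlitz polynomials have the closed form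
  \<open>(1 - Q)\<^sup>m \<beta>\<^sub>m\<^sub>,\<^sub>Q(a) = \<Sum>\<^sub>l binomial m l (-1)\<^sup>l (Q\<^sup>a)\<^sup>l (l + 1) (1 - Q) / (1 - Q ^ (l + 1))\<close>. Put
  \<open>P = w\<^sub>1 \<dots> w\<^sub>n\<close>, \<open>Q = q ^ (P / w\<^sub>\<sigma>\<^sub>(\<^sub>n\<^sub>))\<close> and \<open>y = q ^ (l + 1)\<close>. Then the sum over the \<open>k\<^sub>j\<close> in the \<open>l\<close>-th term is
  a product of geometric sums \<open>(1 - y ^ P) / (1 - y ^ (P / w\<^sub>\<sigma>\<^sub>(\<^sub>j\<^sub>)))\<close> over \<open>j < n\<close>; the missing factor
  \<open>1 - y ^ (P / w\<^sub>\<sigma>\<^sub>(\<^sub>n\<^sub>))\<close> of the denominator is supplied by \<open>1 - Q ^ (l + 1)\<close>, so the result is symmetric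
  in the \<open>w\<^sub>i\<close>. On the analytic side this needs \<open>exp (log q) = q\<close>, the addition theorem for \<open>exp\<close>,
  \<open>log (q ^ M) = M log q\<close>, and that \<open>q\<close> is not a root of unity.
\<close>

subsection \<open>Ultrametric fields\<close>

lemma abs_val_zero [simp]: "abs_val (0::'a::ultrametric_field) = 0"
  using dist_abs_val[of "0::'a" 0] by simp

lemma abs_val_nonneg [simp]: "abs_val (x::'a::ultrametric_field) \<ge> 0"
  using dist_abs_val[of x 0] zero_le_dist[of x 0] by simp

lemma abs_val_eq_0_iff [simp]: "abs_val (x::'a::ultrametric_field) = 0 \<longleftrightarrow> x = 0"
  using dist_abs_val[of x 0] dist_eq_0_iff[of x 0] by simp

lemma abs_val_pos_iff [simp]: "abs_val (x::'a::ultrametric_field) > 0 \<longleftrightarrow> x \<noteq> 0"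
  using abs_val_nonneg[of x] abs_val_eq_0_iff[of x] by linarith

lemma abs_val_le_0_iff [simp]: "abs_val (x::'a::ultrametric_field) \<le> 0 \<longleftrightarrow> x = 0"
  using abs_val_pos_iff[of x] by linarith

lemma abs_val_minus_commute: "abs_val (x - y) = abs_val (y - x :: 'a::ultrametric_field)"
  using dist_abs_val[of x y] dist_abs_val[of y x] dist_commute[of x y] by simp

lemma abs_val_minus [simp]: "abs_val (- x) = abs_val (x :: 'a::ultrametric_field)"
  using abs_val_minus_commute[of 0 x] by simp

lemma abs_val_one [simp]: "abs_val (1::'a::ultrametric_field) = 1"
  using abs_val_mult[of "1::'a" 1] by simp

lemma abs_val_power: "abs_val ((x::'a::ultrametric_field) ^ n) = abs_val x ^ n"
  by (induction n) (auto simp: abs_val_mult)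

lemma abs_val_inverse: "abs_val (inverse (x::'a::ultrametric_field)) = inverse (abs_val x)"
proof (cases "x = 0")
  case False
  then show ?thesis
    using abs_val_mult[of x "inverse x"] by (simp add: field_simps)
qed auto

lemma abs_val_divide: "abs_val (x / y) = abs_val x / abs_val (y::'a::ultrametric_field)"
  by (simp add: divide_inverse abs_val_mult abs_val_inverse)

lemma abs_val_add_le:
  "abs_val x \<le> B \<Longrightarrow> abs_val y \<le> B \<Longrightarrow> abs_val (x + y :: 'a::ultrametric_field) \<le> B"
  using abs_val_add[of x y] by linarith

lemma abs_val_diff_le:
  "abs_val x \<le> B \<Longrightarrow> abs_val y \<le> B \<Longrightarrow> abs_val (x - y :: 'a::ultrametric_field) \<le> B"
  using abs_val_add_le[of x B "- y"] by simp

text \<open>From \<open>x = (x + y) - y\<close>, the value at \<open>x\<close> is at most the larger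
  of those at \<open>x + y\<close> and \<open>y\<close>, and the latter is too small.\<close>

lemma abs_val_add_eq:
  assumes "abs_val y < abs_val (x :: 'a::ultrametric_field)"
  shows "abs_val (x + y) = abs_val x"
  using abs_val_add[of x y] abs_val_add[of "x + y" "- y"] assms by auto

lemma abs_val_sum_le:
  assumes "\<And>i. i \<in> A \<Longrightarrow> abs_val (f i :: 'a::ultrametric_field) \<le> B" and "B \<ge> 0"
  shows "abs_val (sum f A) \<le> B"
  using assms(1)
  by (induction A rule: infinite_finite_induct) (auto simp: assms(2) intro!: abs_val_add_le)

lemma abs_val_of_nat_le: "abs_val (of_nat n :: 'a::ultrametric_field) \<le> 1"
  by (induction n) (auto intro!: abs_val_add_le)

lemma abs_val_of_int_le: "abs_val (of_int n :: 'a::ultrametric_field) \<le> 1"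
  by (cases n) (auto simp: abs_val_of_nat_le simp del: of_nat_Suc intro!: abs_val_diff_le)

section \<open>Convergence of series in complete ultrametric fields\<close>

lemma abs_val_partial_sum_diff_le:
  fixes f :: "nat \<Rightarrow> 'a::ultrametric_field"
  assumes "\<And>k. k \<ge> N \<Longrightarrow> abs_val (f k) \<le> B" and "B \<ge> 0" and "K \<ge> N"
  shows "abs_val ((\<Sum>k<K. f k) - (\<Sum>k<N. f k)) \<le> B"
proof -
  have "(\<Sum>k<K. f k) - (\<Sum>k<N. f k) = (\<Sum>k\<in>{N..<K}. f k)"
    using assms(3) sum.atLeastLessThan_concat[of 0 N K f]
    by (simp add: atLeast0LessThan algebra_simps)
  then show ?thesis
    using assms by (auto intro!: abs_val_sum_le)
qed

text \<open>A block of terms is no larger than its largest term, so a null sequence of terms already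
  makes the partial sums Cauchy.\<close>

lemma ultrametric_summable:
  fixes f :: "nat \<Rightarrow> 'a::ultrametric_field"
  assumes "complete (UNIV :: 'a set)" and "(\<lambda>k. abs_val (f k)) \<longlonglongrightarrow> 0"
  shows "summable f"
proof -
  have "Cauchy (\<lambda>n. \<Sum>k<n. f k)"
  proof (rule metric_CauchyI)
    fix e :: real assume "e > 0"
    then have e: "e / 2 > 0" by simp
    obtain N where N: "\<And>k. k \<ge> N \<Longrightarrow> abs_val (f k) \<le> e / 2"
      using order_tendstoD(2)[OF assms(2) e] unfolding eventually_sequentially
      by (meson less_imp_le)
    have "dist (\<Sum>k<i. f k) (\<Sum>k<j. f k) < e" if "i \<ge> N" "j \<ge> N" for i j
    proof -
      \<comment> \<open>Comparing both partial sums with the \<open>N\<close>-th one avoids a case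
        split on the order of \<open>i\<close> and \<open>j\<close>.\<close>
      have "abs_val (((\<Sum>k<i. f k) - (\<Sum>k<N. f k)) - ((\<Sum>k<j. f k) - (\<Sum>k<N. f k))) \<le> e / 2"
        using N e that by (intro abs_val_diff_le abs_val_partial_sum_diff_le) auto
      then show ?thesis
        using \<open>e > 0\<close> by (simp add: dist_abs_val)
    qed
    then show "\<exists>N. \<forall>i\<ge>N. \<forall>j\<ge>N. dist (\<Sum>k<i. f k) (\<Sum>k<j. f k) < e" by blast
  qed
  then obtain s where "(\<lambda>n. \<Sum>k<n. f k) \<longlonglongrightarrow> s"
    using assms(1) unfolding complete_def by blast
  then show ?thesis
    unfolding summable_def sums_def by blast
qed

text \<open>The finite estimate passes to the limit through a partial sum beyond \<open>N\<close>
  within \<open>e\<close> of \<open>s\<close>. This serves to peel off the leading terms of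
  exp.\<close>

lemma abs_val_sums_diff_le:
  fixes f :: "nat \<Rightarrow> 'a::ultrametric_field"
  assumes "f sums s" and "\<And>k. k \<ge> N \<Longrightarrow> abs_val (f k) \<le> B" and "B \<ge> 0"
  shows "abs_val (s - (\<Sum>k<N. f k)) \<le> B"
proof (rule field_le_epsilon)
  fix e :: real assume e: "e > 0"
  obtain K where K: "\<And>n. n \<ge> K \<Longrightarrow> dist (\<Sum>k<n. f k) s < e"
    using metric_LIMSEQ_D[OF assms(1)[unfolded sums_def] e] by blast
  have "abs_val ((\<Sum>k<max N K. f k) - (\<Sum>k<N. f k)) \<le> B"
    using assms by (intro abs_val_partial_sum_diff_le) auto
  moreover have "abs_val (s - (\<Sum>k<max N K. f k)) < e"
    using K[of "max N K"] by (simp add: dist_abs_val abs_val_minus_commute)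
  ultimately have "abs_val ((s - (\<Sum>k<max N K. f k)) + ((\<Sum>k<max N K. f k) - (\<Sum>k<N. f k))) \<le> B + e"
    using assms(3) e by (intro abs_val_add_le) linarith+
  then show "abs_val (s - (\<Sum>k<N. f k)) \<le> B + e" by simp
qed

subsection \<open>The \<open>p\<close>-adic exponential and logarithm\<close>

locale padic_abs_val =
  fixes p :: nat and T :: "'a::ultrametric_field itself"
  assumes prime_p: "prime p"
    and abs_val_p: "abs_val (of_nat p :: 'a) = 1 / real p"
    and complete_UNIV: "complete (UNIV :: 'a set)"
begin

text \<open>The bound of the theorem is the radius of convergence of exp; on this open disc around
  0, exp will turn out to invert log.\<close>

definition conv_radius :: real where
  "conv_radius = real p powr (- 1 / (real p - 1))"

lemma p_ge_2: "p \<ge> 2"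
  using prime_p by (rule prime_ge_2_nat)

lemma conv_radius_pos: "conv_radius > 0"
  using p_ge_2 by (simp add: conv_radius_def)

lemma conv_radius_le_1: "conv_radius \<le> 1"
proof -
  have "real p powr (- 1 / (real p - 1)) \<le> real p powr 0"
    using p_ge_2 by (intro powr_mono) (auto simp: divide_simps)
  then show ?thesis
    using p_ge_2 by (simp add: conv_radius_def)
qed

text \<open>This ties the radius to factorials: \<open>p - 1\<close> factors of the radius pay for
  one factor \<open>p\<close>.\<close>

lemma conv_radius_power: "conv_radius ^ (p - 1) = 1 / real p"
proof -
  have "conv_radius ^ (p - 1) = real p powr (- 1 / (real p - 1) * real (p - 1))"
    using p_ge_2 by (simp add: conv_radius_def powr_realpow[symmetric] powr_powr)
  also have "- 1 / (real p - 1) * real (p - 1) = - 1"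
    using p_ge_2 by (simp add: of_nat_diff)
  finally show ?thesis
    using p_ge_2 by (simp add: powr_minus_divide)
qed

section \<open>Absolute values of integers and factorials\<close>

lemma abs_val_of_nat_not_dvd:
  assumes "\<not> p dvd n"
  shows "abs_val (of_nat n :: 'a) = 1"
proof (rule ccontr)
  assume "abs_val (of_nat n :: 'a) \<noteq> 1"
  then have n: "abs_val (of_nat n :: 'a) < 1"
    using abs_val_of_nat_le[of n, where 'a='a] by linarith
  have "coprime (int p) (int n)"
    using assms prime_p by (simp add: prime_imp_coprime)
  then obtain a b where "a * int p + b * int n = 1"
    using bezout_int[of "int p" "int n"] by (auto simp: coprime_iff_gcd_eq_1)
  \<comment> \<open>Both summands of this Bezout identity would have absolute value below 1, but
    their sum is 1.\<close>
  then have eq: "of_int a * of_nat p + of_int b * of_nat n = (1::'a)"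
    by (metis of_int_1 of_int_add of_int_mult of_int_of_nat_eq)
  define B where "B = max (1 / real p) (abs_val (of_nat n :: 'a))"
  have "B < 1" using n p_ge_2 by (simp add: B_def)
  have le: "abs_val (of_int c * y :: 'a) \<le> B" if "abs_val y \<le> B" for c and y :: 'a
    using mult_mono[OF abs_val_of_int_le[of c, where 'a='a] that] by (simp add: abs_val_mult)
  have "abs_val (1::'a) \<le> B"
    unfolding eq[symmetric] by (intro abs_val_add_le le) (auto simp: B_def abs_val_p)
  with \<open>B < 1\<close> show False by simp
qed

text \<open>Only the multiples of \<open>p\<close> among the factors of the factorial contribute.\<close>

lemma abs_val_fact:
  "abs_val (fact k :: 'a) = (1 / real p) ^ (k div p) * abs_val (fact (k div p) :: 'a)"
proof (induction k)
  case (Suc k)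
  show ?case
  proof (cases "p dvd Suc k")
    case True
    then have d: "Suc k div p = Suc (k div p)"
      by (simp add: div_Suc mod_eq_0_iff_dvd)
    then have "Suc k = p * Suc (k div p)"
      using True by (metis dvd_mult_div_cancel)
    then have "abs_val (of_nat (Suc k) :: 'a) = 1 / real p * abs_val (of_nat (Suc (k div p)) :: 'a)"
      by (metis abs_val_mult abs_val_p of_nat_mult)
    then show ?thesis
      using Suc by (simp add: d fact_Suc abs_val_mult del: of_nat_Suc)
  next
    case False
    then have d: "Suc k div p = k div p"
      by (simp add: div_Suc mod_eq_0_iff_dvd)
    show ?thesis
      using Suc abs_val_of_nat_not_dvd[OF False]
      by (simp add: d fact_Suc abs_val_mult del: of_nat_Suc)
  qed
qed simp

lemma abs_val_fact_le: "abs_val (fact k :: 'a) \<le> 1"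
  using abs_val_of_nat_le[of "fact k", where 'a='a] by simp

text \<open>This is Legendre's bound v_p(k!) <= (k - 1)/(p - 1), by induction along
  \<open>k div p\<close>. For \<open>k = 0\<close> the truncated exponent is 0.\<close>

lemma abs_val_fact_ge: "abs_val (fact k :: 'a) \<ge> conv_radius ^ (k - 1)"
proof (induction k rule: less_induct)
  case (less k)
  let ?a = "k div p"
  show ?case
  proof (cases "?a = 0")
    case True
    then show ?thesis
      using abs_val_fact[of k] conv_radius_pos conv_radius_le_1 by (simp add: power_le_one)
  next
    case False
    then have "k > 0" by (auto intro: ccontr)
    \<comment> \<open>The \<open>?a\<close> multiples of \<open>p\<close> up to \<open>k\<close>
      cost \<open>p - 1\<close> powers of the radius each; the factorial of \<open>?a\<close> costs
      another \<open>?a - 1\<close> by induction.\<close>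
    have "?a * (p - 1) + (?a - 1) = ?a * p - 1"
      using False p_ge_2 by (cases p; cases ?a) (auto simp: algebra_simps)
    also have "\<dots> \<le> k - 1"
      by (meson diff_le_mono div_times_less_eq_dividend)
    finally have le: "?a * (p - 1) + (?a - 1) \<le> k - 1" .
    have "conv_radius ^ (k - 1) \<le> conv_radius ^ (?a * (p - 1) + (?a - 1))"
      using conv_radius_pos conv_radius_le_1 le by (intro power_decreasing) auto
    also have "\<dots> = (1 / real p) ^ ?a * conv_radius ^ (?a - 1)"
      by (simp add: power_add power_mult conv_radius_power[symmetric] mult.commute[of ?a])
    also have "\<dots> \<le> (1 / real p) ^ ?a * abs_val (fact ?a :: 'a)"
      using less[of ?a] \<open>k > 0\<close> p_ge_2 by (intro mult_left_mono) auto
    finally show ?thesis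
      by (simp add: abs_val_fact[of k])
  qed
qed

section \<open>The exponential series and its addition theorem\<close>

lemma abs_val_exp_term_le:
  assumes "k \<ge> 1"
  shows "abs_val (z ^ k / fact k :: 'a) \<le> abs_val z * (abs_val z / conv_radius) ^ (k - 1)"
proof -
  have "abs_val (z ^ k / fact k :: 'a) = abs_val z ^ k / abs_val (fact k :: 'a)"
    by (simp add: abs_val_divide abs_val_power)
  also have "\<dots> \<le> abs_val z ^ k / conv_radius ^ (k - 1)"
    using abs_val_fact_ge[of k] conv_radius_pos by (intro divide_left_mono) auto
  \<comment> \<open>The exponent \<open>k - 1\<close> in the factorial bound leaves one factor
    \<open>abs_val z\<close> undivided, so all terms from \<open>k = 1\<close> on are at most
    \<open>abs_val z\<close> inside the disc.\<close>
  also have "\<dots> = abs_val z * (abs_val z / conv_radius) ^ (k - 1)"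
    using assms by (cases k) (auto simp: power_divide)
  finally show ?thesis .
qed

lemma abs_val_exp_term_le_power:
  "abs_val (z ^ k / fact k :: 'a) \<le> (abs_val z / conv_radius) ^ k"
proof (cases k)
  case (Suc j)
  have "abs_val z \<le> abs_val z / conv_radius"
    using conv_radius_pos conv_radius_le_1 by (simp add: field_simps mult_left_le mult_left_le_one_le)
  then have "abs_val z * (abs_val z / conv_radius) ^ j \<le> (abs_val z / conv_radius) ^ k"
    unfolding Suc power_Suc using conv_radius_pos by (intro mult_right_mono) auto
  then show ?thesis
    using abs_val_exp_term_le[of k z] Suc by simp
qed auto

lemma abs_val_exp_term_le_abs_val:
  assumes "abs_val z < conv_radius" and "k \<ge> 1"
  shows "abs_val (z ^ k / fact k :: 'a) \<le> abs_val z"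
proof -
  have "(abs_val z / conv_radius) ^ (k - 1) \<le> 1"
    using assms conv_radius_pos by (intro power_le_one) auto
  then show ?thesis
    using abs_val_exp_term_le[OF assms(2), of z] mult_left_mono[of _ 1 "abs_val z"] by force
qed

lemma abs_val_exp_term_less:
  assumes "abs_val z < conv_radius" and "k \<ge> 2" and "z \<noteq> 0"
  shows "abs_val (z ^ k / fact k :: 'a) < abs_val z"
proof -
  \<comment> \<open>Here \<open>k - 1\<close> is read as \<open>Suc (k - 2)\<close>, a positive
    exponent.\<close>
  have "(abs_val z / conv_radius) ^ (k - 1) < 1"
    using assms conv_radius_pos by (intro power_Suc_less_one[of _ "k - 2", THEN back_subst[of "\<lambda>n. _ ^ n < 1"]]) auto
  then have "abs_val z * (abs_val z / conv_radius) ^ (k - 1) < abs_val z * 1"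
    using assms(3) by (intro mult_strict_left_mono) auto
  then show ?thesis
    using abs_val_exp_term_le[of k z] assms(2) by simp
qed

lemma tendsto_exp_term:
  assumes "abs_val (z::'a) < conv_radius"
  shows "(\<lambda>k. abs_val (z ^ k / fact k)) \<longlonglongrightarrow> 0"
proof (rule tendsto_sandwich[OF _ _ tendsto_const])
  show "(\<lambda>k. (abs_val z / conv_radius) ^ k) \<longlonglongrightarrow> 0"
    using assms conv_radius_pos by (intro LIMSEQ_power_zero) auto
qed (auto simp: abs_val_exp_term_le_power)

lemma padic_exp_sums:
  assumes "abs_val (z::'a) < conv_radius"
  shows "(\<lambda>k. z ^ k / fact k) sums padic_exp z"
  unfolding padic_exp_def
  by (intro summable_sums ultrametric_summable complete_UNIV tendsto_exp_term assms)

lemma padic_exp_0 [simp]: "padic_exp (0::'a) = 1"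
  using abs_val_sums_diff_le[OF padic_exp_sums[of 0], of 1 0] conv_radius_pos by simp

lemma abs_val_padic_exp_minus_1:
  assumes "abs_val (z::'a) < conv_radius"
  shows "abs_val (padic_exp z - 1) \<le> abs_val z"
  using abs_val_sums_diff_le[OF padic_exp_sums[OF assms], of 1 "abs_val z"]
    abs_val_exp_term_le_abs_val[OF assms] by simp

lemma abs_val_padic_exp:
  assumes "abs_val (z::'a) < conv_radius"
  shows "abs_val (padic_exp z) = 1"
  using abs_val_padic_exp_minus_1[OF assms] assms conv_radius_le_1
    abs_val_add_eq[of "padic_exp z - 1" 1] by simp

text \<open>Compare partial sums: the product of the two differs from that for \<open>u + v\<close>
  only by terms with \<open>i + j \<ge> n\<close>, and these and all tails are bounded by
  \<open>\<theta> ^ n\<close>.\<close>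

lemma padic_exp_add:
  assumes "abs_val (u::'a) < conv_radius" and "abs_val v < conv_radius"
  shows "padic_exp (u + v) = padic_exp u * padic_exp v"
proof -
  \<comment> \<open>One ratio serves for \<open>u\<close>, \<open>v\<close> and, by the ultrametric
    inequality, \<open>u + v\<close>.\<close>
  define \<theta> where "\<theta> = max (abs_val u) (abs_val v) / conv_radius"
  define E where "E n z = (\<Sum>k<n. z ^ k / fact k)" for n and z :: 'a
  have \<theta>: "0 \<le> \<theta>" "\<theta> < 1"
    using assms conv_radius_pos by (auto simp: \<theta>_def le_max_iff_disj)
  have le: "abs_val (z ^ k / fact k) \<le> \<theta> ^ k"
    if "abs_val z \<le> max (abs_val u) (abs_val v)" for k and z :: 'a
    using abs_val_exp_term_le_power[of z k] that conv_radius_pos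
    by (elim order_trans) (auto simp: \<theta>_def intro!: power_mono divide_right_mono)
  have tail: "abs_val (padic_exp z - E n z) \<le> \<theta> ^ n"
    if z: "abs_val z \<le> max (abs_val u) (abs_val v)" for n z
    unfolding E_def
  proof (rule abs_val_sums_diff_le[OF padic_exp_sums])
    show "abs_val (z ^ k / fact k) \<le> \<theta> ^ n" if "k \<ge> n" for k
      using le[OF z, of k] power_decreasing[OF that, of \<theta>] \<theta> by linarith
  qed (use z assms \<theta> in auto)
  have E1: "abs_val (E n z) \<le> 1" if z: "abs_val z \<le> max (abs_val u) (abs_val v)" for n z
    unfolding E_def
    using order_trans[OF le[OF z] power_le_one] \<theta> by (intro abs_val_sum_le) auto
  have E_add: "abs_val (E n u * E n v - E n (u + v)) \<le> \<theta> ^ n" for n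
  proof -
    let ?f = "\<lambda>(i,j). (u ^ i / fact i) * (v ^ j / fact j)"
    have "E n (u + v) = (\<Sum>k<n. \<Sum>i\<le>k. ?f (i, k - i))"
      unfolding E_def
    proof (rule sum.cong)
      fix k
      have "(u + v) ^ k / fact k = (\<Sum>i\<le>k. of_nat (k choose i) * u ^ i * v ^ (k - i) / fact k)"
        by (simp add: binomial_ring sum_divide_distrib)
      also have "\<dots> = (\<Sum>i\<le>k. ?f (i, k - i))"
        by (intro sum.cong) (auto simp: binomial_fact field_simps)
      finally show "(u + v) ^ k / fact k = (\<Sum>i\<le>k. ?f (i, k - i))" .
    qed auto
    also have "\<dots> = sum ?f {(i, j). i + j < n}"
      by (simp add: sum.triangle_reindex)
    finally have 1: "E n (u + v) = sum ?f {(i, j). i + j < n}" .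
    have "E n u * E n v = sum ?f ({..<n} \<times> {..<n})"
      by (simp add: E_def sum_product sum.cartesian_product)
    also have "\<dots> = sum ?f {(i, j). i + j < n} + sum ?f ({..<n} \<times> {..<n} - {(i, j). i + j < n})"
      by (subst sum.subset_diff[of "{(i, j). i + j < n}"]) auto
    finally have "E n u * E n v - E n (u + v) = sum ?f ({..<n} \<times> {..<n} - {(i, j). i + j < n})"
      using 1 by simp
    also have "abs_val \<dots> \<le> \<theta> ^ n"
    proof (rule abs_val_sum_le)
      fix x assume "x \<in> {..<n} \<times> {..<n} - {(i, j). i + j < n}"
      then obtain i j where x: "x = (i, j)" "i + j \<ge> n" by auto
      have "abs_val (?f (i, j)) \<le> \<theta> ^ i * \<theta> ^ j"
        using le[of u i] le[of v j] \<theta>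
        by (simp only: abs_val_mult prod.case) (intro mult_mono, auto)
      also have "\<dots> \<le> \<theta> ^ n"
        using \<theta> x(2) by (auto simp: power_add[symmetric] intro!: power_decreasing)
      finally show "abs_val (?f x) \<le> \<theta> ^ n" using x(1) by simp
    qed (use \<theta> in auto)
    finally show ?thesis .
  qed
  have "abs_val (padic_exp (u + v) - padic_exp u * padic_exp v) \<le> \<theta> ^ n" for n
  proof -
    have uv: "abs_val (u + v) \<le> max (abs_val u) (abs_val v)" by (rule abs_val_add)
    have mult_le: "abs_val (a * b) \<le> \<theta> ^ n" if "abs_val a \<le> \<theta> ^ n" "abs_val b \<le> 1" for a b :: 'a
      using mult_mono[OF that] \<theta> by (simp add: abs_val_mult)
    \<comment> \<open>A telescoping into four errors, each at most \<open>\<theta> ^ n\<close>; the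
      cofactors \<open>padic_exp v\<close> and \<open>E n u\<close> have absolute value at most
      1.\<close>
    have "padic_exp (u + v) - padic_exp u * padic_exp v =
      (padic_exp (u + v) - E n (u + v)) - (E n u * E n v - E n (u + v))
      - (padic_exp u - E n u) * padic_exp v - (padic_exp v - E n v) * E n u"
      by (simp add: algebra_simps)
    also have "abs_val \<dots> \<le> \<theta> ^ n"
      using assms uv by (intro abs_val_diff_le mult_le tail E_add E1) (auto simp: abs_val_padic_exp)
    finally show ?thesis .
  qed
  moreover have "(\<lambda>n. \<theta> ^ n) \<longlonglongrightarrow> 0"
    using \<theta> by (intro LIMSEQ_power_zero) auto
  ultimately have "abs_val (padic_exp (u + v) - padic_exp u * padic_exp v) \<le> 0"
    by (meson LIMSEQ_le_const)
  then show ?thesis by simp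
qed


lemma padic_exp_of_nat_mult:
  assumes "abs_val (z::'a) < conv_radius"
  shows "padic_exp (of_nat n * z) = padic_exp z ^ n"
proof (induction n)
  case (Suc n)
  have "abs_val (of_nat n * z) < conv_radius"
    using assms mult_right_mono[OF abs_val_of_nat_le[of n, where 'a='a] abs_val_nonneg[of z]]
    by (simp add: abs_val_mult)
  then show ?case
    using Suc assms by (simp add: algebra_simps padic_exp_add)
qed auto

text \<open>By the addition theorem it suffices that \<open>padic_exp z = 1\<close> forces
  \<open>z = 0\<close>, which holds because the linear term dominates all later ones.\<close>

lemma padic_exp_inject:
  assumes "abs_val (u::'a) < conv_radius" and "abs_val v < conv_radius"
    and "padic_exp u = padic_exp v"
  shows "u = v"
proof (rule ccontr)
  assume "u \<noteq> v"
  define z where "z = u - v"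
  have "z \<noteq> 0" using \<open>u \<noteq> v\<close> by (simp add: z_def)
  have z: "abs_val z < conv_radius"
    using abs_val_diff_le[of u "max (abs_val u) (abs_val v)" v] assms(1,2) by (simp add: z_def)
  have "padic_exp z * padic_exp v = padic_exp v"
    using padic_exp_add[OF z assms(2)] assms(3) by (simp add: z_def)
  moreover have "padic_exp v \<noteq> 0"
    using abs_val_padic_exp[OF assms(2)] by auto
  ultimately have "padic_exp z = 1" by simp
  \<comment> \<open>Terms with \<open>k \<ge> 2\<close> keep at least one factor
    \<open>abs_val z / conv_radius < 1\<close>, so exp z - 1 - z is bounded by \<open>B\<close>,
    which is smaller than \<open>abs_val z\<close>.\<close>
  define B where "B = abs_val z * (abs_val z / conv_radius)"
  have ratio: "abs_val z / conv_radius < 1"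
    using z conv_radius_pos by simp
  have "abs_val (padic_exp z - (\<Sum>k<2. z ^ k / fact k)) \<le> B"
  proof (rule abs_val_sums_diff_le[OF padic_exp_sums[OF z]])
    fix k :: nat assume k: "k \<ge> 2"
    have "(abs_val z / conv_radius) ^ (k - 1) \<le> (abs_val z / conv_radius) ^ 1"
      using k ratio conv_radius_pos by (intro power_decreasing) auto
    then have "abs_val z * (abs_val z / conv_radius) ^ (k - 1) \<le> B"
      unfolding B_def by (intro mult_left_mono) auto
    then show "abs_val (z ^ k / fact k) \<le> B"
      using abs_val_exp_term_le[of k z] k by simp
  qed (use conv_radius_pos in \<open>simp add: B_def\<close>)
  then have "abs_val z \<le> B"
    using \<open>padic_exp z = 1\<close> by (simp add: numeral_2_eq_2)
  also have "B < abs_val z * 1"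
    unfolding B_def using ratio \<open>z \<noteq> 0\<close> by (intro mult_strict_left_mono) auto
  finally show False by simp
qed

section \<open>Powers of \<open>1 + t\<close> and the logarithm\<close>

text \<open>
  The linear term of the binomial expansion dominates, since \<open>binomial M k s ^ k\<close> is an integral
  multiple of \<open>M s ^ k / k!\<close> and \<open>\<bar>s ^ k / k!\<bar> < \<bar>s\<bar>\<close> for \<open>k \<ge> 2\<close>.
\<close>

lemma abs_val_power_minus_1:
  assumes "abs_val (s::'a) < conv_radius"
  shows "abs_val ((1 + s) ^ M - 1) = abs_val (of_nat M :: 'a) * abs_val s"
proof (cases "M = 0 \<or> s = 0")
  case False
  then have M: "M > 0" "s \<noteq> 0" by auto
  have term_less: "abs_val (of_nat (M choose k) * s ^ k) < abs_val (of_nat M * s)" if k: "k \<ge> 2" for k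
  proof -
    obtain j where j: "k = Suc j" using k by (cases k) auto
    have "of_nat k * of_nat (M choose k) = (of_nat M * of_nat (M - 1 choose j) :: 'a)"
      using binomial_absorption[of j M] by (simp only: j of_nat_mult[symmetric])
    then have "of_nat (M choose k) = of_nat M * of_nat (M - 1 choose j) / (of_nat k :: 'a)"
      using k by (simp add: field_simps)
    then have "of_nat (M choose k) * s ^ k =
        of_nat M * (of_nat (M - 1 choose j) * fact j) * (s ^ k / fact k)"
      by (simp add: j fact_Suc field_simps del: of_nat_Suc)
    also have "abs_val \<dots> =
        abs_val (of_nat M :: 'a) * (abs_val (of_nat ((M - 1 choose j) * fact j) :: 'a) * abs_val (s ^ k / fact k))"
      by (simp only: abs_val_mult of_nat_mult of_nat_fact)
    also have "\<dots> \<le> abs_val (of_nat M :: 'a) * (1 * abs_val (s ^ k / fact k))"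
      by (intro mult_left_mono mult_right_mono abs_val_of_nat_le) auto
    also have "\<dots> < abs_val (of_nat M :: 'a) * abs_val s"
      using abs_val_exp_term_less[OF assms k M(2)] M by (simp add: mult_strict_left_mono)
    finally show ?thesis by (simp add: abs_val_mult)
  qed
  define S where "S = (\<Sum>k\<in>{2..M}. of_nat (M choose k) * s ^ k)"
  have "(1 + s) ^ M = (\<Sum>k\<le>M. of_nat (M choose k) * s ^ k)"
    using binomial_ring[of s 1 M] by (simp add: add.commute)
  also have "{..M} = insert 0 (insert 1 {2..M})"
    using M by auto
  also have "(\<Sum>k\<in>insert 0 (insert 1 {2..M}). of_nat (M choose k) * s ^ k) = 1 + (of_nat M * s + S)"
    by (subst sum.insert; simp add: S_def)
  finally have eq: "(1 + s) ^ M - 1 = of_nat M * s + S" by simp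
  have "abs_val S < abs_val (of_nat M * s)"
  proof (cases "{2..M} = {}")
    case True
    then show ?thesis using M by (simp add: S_def abs_val_mult)
  next
    case False
    \<comment> \<open>The sum estimate takes only a weak bound, so strictness goes through the
      maximum over the finite, here nonempty, range.\<close>
    define B where "B = Max ((\<lambda>k. abs_val (of_nat (M choose k) * s ^ k)) ` {2..M})"
    have "B < abs_val (of_nat M * s)"
      unfolding B_def using False term_less by (subst Max_less_iff) auto
    moreover have le: "abs_val (of_nat (M choose k) * s ^ k) \<le> B" if "k \<in> {2..M}" for k
      unfolding B_def using that by (intro Max_ge) auto
    moreover have "B \<ge> 0"
      using False le by (metis abs_val_nonneg ex_in_conv order_trans)
    ultimately show ?thesis
      unfolding S_def using abs_val_sum_le[of "{2..M}" _ B] by (meson le_less_trans)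
  qed
  then show ?thesis
    unfolding eq by (simp add: abs_val_add_eq abs_val_mult)
qed auto

text \<open>k! binomial(M - 1, k) = (M - 1)(M - 2)...(M - k) is congruent to (-1)(-2)...(-k) modulo
  \<open>M\<close>.\<close>

lemma abs_val_fact_binomial_diff:
  assumes "M > 0"
  shows "abs_val (fact k * of_nat (M - 1 choose k) - (- 1) ^ k * fact k :: 'a) \<le> abs_val (of_nat M :: 'a)"
proof (induction k)
  case (Suc k)
  let ?g = "\<lambda>k. fact k * of_nat (M - 1 choose k) :: 'a"
  have "of_nat (Suc k) * of_nat (M - 1 choose Suc k) = (of_nat (M - 1 choose k) * (of_nat (M - 1) - of_nat k) :: 'a)"
  proof (cases "k \<le> M - 1")
    case True
    then show ?thesis
      using binomial_absorb_comp[of "M - 1" k] binomial_absorption[of k "M - 1"]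
      by (metis (mono_tags, lifting) mult.commute of_nat_diff of_nat_mult binomial_absorb_comp binomial_absorption)
  qed (simp add: binomial_eq_0)
  moreover have "?g (Suc k) = fact k * (of_nat (Suc k) * of_nat (M - 1 choose Suc k))"
    by (simp add: fact_Suc ac_simps del: of_nat_Suc)
  ultimately have "?g (Suc k) = ?g k * (of_nat (M - 1) - of_nat k)"
    by (simp only: mult.assoc)
  \<comment> \<open>The new difference is an integral multiple of \<open>M\<close> minus an integral
    multiple of the old difference.\<close>
  then have "?g (Suc k) - (- 1) ^ Suc k * fact (Suc k) =
      of_nat (fact k * (M - 1 choose k)) * of_nat M - of_nat (Suc k) * (?g k - (- 1) ^ k * fact k)"
    using assms by (simp add: of_nat_diff algebra_simps)
  also have "abs_val \<dots> \<le> abs_val (of_nat M :: 'a)"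
    using mult_mono[OF abs_val_of_nat_le[of "fact k * (M - 1 choose k)", where 'a='a]
        order_refl[of "abs_val (of_nat M :: 'a)"]]
      mult_mono[OF abs_val_of_nat_le[of "Suc k", where 'a='a] Suc.IH]
    by (intro abs_val_diff_le) (simp_all add: abs_val_mult del: of_nat_mult of_nat_Suc)
  finally show ?case .
qed auto

text \<open>Terms of log are dominated by terms of exp, so log converges on the same disc.\<close>

lemma abs_val_divide_of_nat_le: "abs_val (x / of_nat (Suc k) :: 'a) \<le> abs_val (x / fact (Suc k))"
proof -
  have "abs_val (x / of_nat (Suc k) :: 'a) = abs_val (x / fact (Suc k)) * abs_val (fact k :: 'a)"
    by (simp add: abs_val_divide abs_val_mult fact_Suc del: of_nat_Suc)
  also have "\<dots> \<le> abs_val (x / fact (Suc k)) * 1"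
    by (intro mult_left_mono abs_val_fact_le) auto
  finally show ?thesis by simp
qed

lemma padic_log_sums:
  assumes "abs_val (t::'a) < conv_radius"
  shows "(\<lambda>k. (- 1) ^ k * t ^ Suc k / of_nat (Suc k)) sums padic_log (1 + t)"
proof -
  have "(\<lambda>k. abs_val ((- 1) ^ k * t ^ Suc k / of_nat (Suc k))) \<longlonglongrightarrow> 0"
  proof (rule tendsto_sandwich[OF _ _ tendsto_const])
    show "(\<lambda>k. abs_val (t ^ Suc k / fact (Suc k))) \<longlonglongrightarrow> 0"
      using LIMSEQ_Suc[OF tendsto_exp_term[OF assms]] .
    have "abs_val ((- 1) ^ k * t ^ Suc k / of_nat (Suc k)) \<le> abs_val (t ^ Suc k / fact (Suc k))" for k
      using abs_val_divide_of_nat_le[of "t ^ Suc k" k]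
      by (simp add: abs_val_mult abs_val_divide abs_val_power del: of_nat_Suc power_Suc fact_Suc)
    then show "\<forall>\<^sub>F k in sequentially. abs_val ((- 1) ^ k * t ^ Suc k / of_nat (Suc k)) \<le> abs_val (t ^ Suc k / fact (Suc k))"
      by (intro always_eventually allI)
  qed auto
  then show ?thesis
    unfolding padic_log_def add_diff_cancel_left'
    by (intro summable_sums ultrametric_summable complete_UNIV)
qed

lemma padic_log_1 [simp]: "padic_log (1::'a) = 0"
  using abs_val_sums_diff_le[OF padic_log_sums[of 0], of 0 0] conv_radius_pos by simp

text \<open>Compare the binomial expansion with \<open>M\<close> times the log series term by term.
  Each difference has one factor \<open>M\<close> from the absorption identity and a second from the
  congruence for \<open>fact k * of_nat (M - 1 choose k)\<close>.\<close>

lemma abs_val_power_minus_1_minus_log: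
  assumes t: "abs_val (t::'a) < conv_radius"
  shows "abs_val ((1 + t) ^ M - 1 - of_nat M * padic_log (1 + t)) \<le> abs_val (of_nat M :: 'a) ^ 2 * abs_val t"
proof (cases "M = 0 \<or> t = 0")
  case False
  then have M: "M > 0" "t \<noteq> 0" by auto
  define f where "f k = (- 1) ^ k * t ^ Suc k / (of_nat (Suc k) :: 'a)" for k
  define D where "D k = of_nat (M choose Suc k) * t ^ Suc k - of_nat M * f k" for k
  let ?B = "abs_val (of_nat M :: 'a) ^ 2 * abs_val t"
  have B: "?B > 0" using M by simp
  have D_le: "abs_val (D k) \<le> ?B" for k
  proof -
    have "of_nat (Suc k) * of_nat (M choose Suc k) = (of_nat M * of_nat (M - 1 choose k) :: 'a)"
      using binomial_absorption[of k M] by (simp only: of_nat_mult[symmetric])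
    then have "of_nat (M choose Suc k) = of_nat M * of_nat (M - 1 choose k) / (of_nat (Suc k) :: 'a)"
      by (simp add: field_simps del: of_nat_Suc)
    then have "D k = of_nat M * ((fact k * of_nat (M - 1 choose k) - (- 1) ^ k * fact k) * (t ^ Suc k / fact (Suc k)))"
      by (simp add: D_def f_def fact_Suc field_simps del: of_nat_Suc)
    also have "abs_val \<dots> \<le> abs_val (of_nat M :: 'a) * (abs_val (of_nat M :: 'a) * abs_val t)"
      unfolding abs_val_mult[of _ "t ^ Suc k / fact (Suc k)"] abs_val_mult[of "of_nat M"]
      by (intro mult_left_mono mult_mono abs_val_fact_binomial_diff abs_val_exp_term_le_abs_val t M) auto
    finally show ?thesis by (simp add: power2_eq_square mult.assoc)
  qed
  obtain K0 where K0: "\<And>n. n \<ge> K0 \<Longrightarrow> dist (\<Sum>k<n. f k) (padic_log (1 + t)) < ?B"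
    using metric_LIMSEQ_D[OF padic_log_sums[OF t, unfolded sums_def, folded f_def] B] by blast
  \<comment> \<open>Beyond \<open>K0\<close> the log tail is below the target bound; beyond
    \<open>M\<close> the binomial expansion is complete.\<close>
  define K where "K = max K0 M"
  have "(1 + t) ^ M = (\<Sum>k\<le>M. of_nat (M choose k) * t ^ k)"
    using binomial_ring[of t 1 M] by (simp add: add.commute)
  also have "\<dots> = (\<Sum>k<Suc K. of_nat (M choose k) * t ^ k)"
    by (rule sum.mono_neutral_left) (auto simp: K_def binomial_eq_0)
  also have "\<dots> = 1 + (\<Sum>k<K. of_nat (M choose Suc k) * t ^ Suc k)"
    by (subst sum.lessThan_Suc_shift) simp
  finally have "(1 + t) ^ M - 1 - of_nat M * padic_log (1 + t) =
      (\<Sum>k<K. D k) + of_nat M * ((\<Sum>k<K. f k) - padic_log (1 + t))"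
    by (simp add: D_def sum_subtractf sum_distrib_left algebra_simps)
  also have "abs_val \<dots> \<le> ?B"
  proof (rule abs_val_add_le)
    show "abs_val (sum D {..<K}) \<le> ?B"
      using D_le B by (intro abs_val_sum_le) auto
    have "abs_val (of_nat M * ((\<Sum>k<K. f k) - padic_log (1 + t))) \<le> 1 * ?B"
      unfolding abs_val_mult using K0[of K]
      by (intro mult_mono abs_val_of_nat_le) (auto simp: K_def dist_abs_val)
    then show "abs_val (of_nat M * ((\<Sum>k<K. f k) - padic_log (1 + t))) \<le> ?B" by simp
  qed
  finally show ?thesis .
qed auto

text \<open>The preceding estimate with \<open>M = 1\<close> bounds t - log(1 + t) by
  \<open>abs_val t\<close>.\<close>

lemma abs_val_padic_log_le:
  assumes "abs_val (t::'a) < conv_radius"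
  shows "abs_val (padic_log (1 + t)) \<le> abs_val t"
proof -
  have "abs_val (t - (t - padic_log (1 + t))) \<le> abs_val t"
    by (rule abs_val_diff_le[OF order_refl])
      (use abs_val_power_minus_1_minus_log[OF assms, of 1] in auto)
  then show ?thesis by simp
qed

text \<open>In the series of exp(M v) the terms from \<open>k = 2\<close> on carry the factor
  \<open>M ^ k\<close>, hence at least two factors \<open>M\<close>.\<close>

lemma abs_val_exp_minus_1_minus:
  assumes v: "abs_val (v::'a) < conv_radius"
  shows "abs_val (padic_exp v ^ M - 1 - of_nat M * v) \<le> abs_val (of_nat M :: 'a) ^ 2 * abs_val v"
proof -
  have Mv: "abs_val (of_nat M * v) < conv_radius"
    using v mult_right_mono[OF abs_val_of_nat_le[of M, where 'a='a] abs_val_nonneg[of v]]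
    by (simp add: abs_val_mult)
  have "abs_val (padic_exp (of_nat M * v) - (\<Sum>k<2. (of_nat M * v) ^ k / fact k)) \<le> abs_val (of_nat M :: 'a) ^ 2 * abs_val v"
  proof (rule abs_val_sums_diff_le[OF padic_exp_sums[OF Mv]])
    fix k :: nat assume k: "k \<ge> 2"
    have "abs_val ((of_nat M * v) ^ k / fact k) = abs_val (of_nat M :: 'a) ^ k * abs_val (v ^ k / fact k)"
      by (simp add: abs_val_mult abs_val_divide abs_val_power power_mult_distrib)
    also have "\<dots> \<le> abs_val (of_nat M :: 'a) ^ 2 * abs_val v"
      using k by (intro mult_mono power_decreasing abs_val_of_nat_le abs_val_exp_term_le_abs_val v) auto
    finally show "abs_val ((of_nat M * v) ^ k / fact k) \<le> abs_val (of_nat M :: 'a) ^ 2 * abs_val v" .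
  qed auto
  then show ?thesis
    unfolding padic_exp_of_nat_mult[OF v] by (simp add: numeral_2_eq_2 algebra_simps)
qed

text \<open>
  The ratio \<open>(1 + t) / exp (log (1 + t)) = 1 + s\<close> satisfies \<open>\<bar>(1 + s) ^ M - 1\<bar> = \<bar>M\<bar> \<bar>s\<bar>\<close>, while numerator
  and denominator to the power \<open>M\<close> agree up to \<open>\<bar>M\<bar>\<^sup>2\<close>; let \<open>M\<close> tend to \<open>0\<close> through the powers of \<open>p\<close>.
\<close>

lemma padic_exp_log:
  assumes t: "abs_val (t::'a) < conv_radius"
  shows "padic_exp (padic_log (1 + t)) = 1 + t"
proof -
  define v where "v = padic_log (1 + t)"
  define e where "e = padic_exp v"
  define s where "s = (1 + t) / e - 1"
  have v_le: "abs_val v \<le> abs_val t"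
    unfolding v_def by (rule abs_val_padic_log_le[OF t])
  then have v: "abs_val v < conv_radius" using t by simp
  have e: "abs_val e = 1"
    unfolding e_def by (rule abs_val_padic_exp[OF v])
  then have "e \<noteq> 0" by auto
  \<comment> \<open>This form shows that \<open>s\<close> lies in the disc, as the exact formula for
    its powers requires.\<close>
  have "s = (t - (e - 1)) / e"
    using \<open>e \<noteq> 0\<close> by (simp add: s_def field_simps)
  then have "abs_val s = abs_val (t - (e - 1))"
    by (simp add: abs_val_divide e)
  also have "\<dots> \<le> abs_val t"
    using abs_val_padic_exp_minus_1[OF v] v_le by (intro abs_val_diff_le[OF order_refl]) (auto simp: e_def)
  finally have s: "abs_val s < conv_radius" using t by simp
  have bound: "abs_val (of_nat M :: 'a) * abs_val s \<le> abs_val (of_nat M :: 'a) ^ 2 * abs_val t" for M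
  proof -
    have "(1 + s) ^ M - 1 = ((1 + t) ^ M - e ^ M) / e ^ M"
      using \<open>e \<noteq> 0\<close> by (simp add: s_def power_divide diff_divide_distrib)
    then have "abs_val ((1 + s) ^ M - 1) = abs_val ((1 + t) ^ M - e ^ M)"
      by (simp add: abs_val_divide abs_val_power e)
    also have "\<dots> = abs_val (((1 + t) ^ M - 1 - of_nat M * v) - (e ^ M - 1 - of_nat M * v))"
      by simp
    also have "\<dots> \<le> abs_val (of_nat M :: 'a) ^ 2 * abs_val t"
    proof (rule abs_val_diff_le)
      show "abs_val (e ^ M - 1 - of_nat M * v) \<le> abs_val (of_nat M :: 'a) ^ 2 * abs_val t"
        unfolding e_def using v_le
        by (intro order_trans[OF abs_val_exp_minus_1_minus[OF v]] mult_left_mono) auto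
    qed (use abs_val_power_minus_1_minus_log[OF t] in \<open>simp add: v_def\<close>)
    finally show ?thesis
      by (simp add: abs_val_power_minus_1[OF s])
  qed
  have "abs_val s \<le> (1 / real p) ^ N * abs_val t" for N
  proof -
    have "abs_val (of_nat (p ^ N) :: 'a) = (1 / real p) ^ N"
      by (simp add: abs_val_power abs_val_p)
    then have "(1 / real p) ^ N * abs_val s \<le> (1 / real p) ^ N * ((1 / real p) ^ N * abs_val t)"
      using bound[of "p ^ N"] by (simp only: power2_eq_square mult.assoc)
    then show ?thesis
      using p_ge_2 by (subst (asm) mult_le_cancel_left_pos) auto
  qed
  moreover have "(\<lambda>N. (1 / real p) ^ N * abs_val t) \<longlonglongrightarrow> 0"
    using p_ge_2 by (intro tendsto_mult_left_zero LIMSEQ_power_zero) auto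
  ultimately have "abs_val s \<le> 0"
    by (meson LIMSEQ_le_const)
  then show ?thesis
    using \<open>e \<noteq> 0\<close> by (simp add: s_def e_def v_def)
qed

lemma abs_val_power_minus_1_less:
  assumes "abs_val (t::'a) < conv_radius"
  shows "abs_val ((1 + t) ^ M - 1) < conv_radius"
  using assms mult_right_mono[OF abs_val_of_nat_le[of M, where 'a='a] abs_val_nonneg[of t]]
  by (simp add: abs_val_power_minus_1)

text \<open>Both sides lie in the disc and have exponential \<open>(1 + t) ^ M\<close>; exp is
  injective there.\<close>

lemma padic_log_power:
  assumes t: "abs_val (t::'a) < conv_radius"
  shows "padic_log ((1 + t) ^ M) = of_nat M * padic_log (1 + t)"
proof (rule padic_exp_inject)
  have u: "abs_val ((1 + t) ^ M - 1) < conv_radius"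
    by (rule abs_val_power_minus_1_less[OF t])
  show "abs_val (padic_log ((1 + t) ^ M)) < conv_radius"
    using abs_val_padic_log_le[OF u] u by simp
  have v: "abs_val (padic_log (1 + t)) < conv_radius"
    using abs_val_padic_log_le[OF t] t by simp
  show "abs_val (of_nat M * padic_log (1 + t)) < conv_radius"
    using v mult_right_mono[OF abs_val_of_nat_le[of M, where 'a='a] abs_val_nonneg[of "padic_log (1 + t)"]]
    by (simp add: abs_val_mult)
  show "padic_exp (padic_log ((1 + t) ^ M)) = padic_exp (of_nat M * padic_log (1 + t))"
    using padic_exp_log[OF u] by (simp add: padic_exp_of_nat_mult[OF v] padic_exp_log[OF t])
qed

text \<open>The exact value |M| |t| of the difference is nonzero. This keeps the Carlitz recursion
  solvable and all later denominators nonzero.\<close>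

lemma power_neq_1:
  assumes "abs_val (t::'a) < conv_radius" and "t \<noteq> 0" and "M > 0"
  shows "(1 + t) ^ M \<noteq> 1"
  using abs_val_power_minus_1[OF assms(1), of M] assms(2,3) by auto

end

subsection \<open>Closed form of the Carlitz polynomials\<close>

text \<open>After swapping the sums, the product of binomials becomes binomial(m, i) binomial(m - i,
  l - i), and the inner sum is (A + (1 - A))^(m - i) = 1. It is applied with \<open>A = Q\<close> to
  the recursion and with A = Q^a to the polynomials.\<close>

lemma sum_choose_mult_choose:
  fixes A :: "'a::comm_ring_1"
  shows "(\<Sum>l\<le>m. of_nat (m choose l) * A ^ l * (1 - A) ^ (m - l) * (\<Sum>i\<le>l. of_nat (l choose i) * d i)) =
    (\<Sum>i\<le>m. of_nat (m choose i) * A ^ i * d i)"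
proof -
  let ?f = "\<lambda>l i. of_nat (m choose l) * A ^ l * (1 - A) ^ (m - l) * (of_nat (l choose i) * d i)"
  have "(\<Sum>l\<le>m. of_nat (m choose l) * A ^ l * (1 - A) ^ (m - l) * (\<Sum>i\<le>l. of_nat (l choose i) * d i)) =
      (\<Sum>l\<le>m. \<Sum>i\<le>l. ?f l i)"
    by (simp add: sum_distrib_left)
  also have "\<dots> = (\<Sum>i\<le>m. \<Sum>l=i..m. ?f l i)"
  proof -
    have "(\<Sum>l\<le>m. \<Sum>i | i \<in> {..m} \<and> i \<le> l. ?f l i) = (\<Sum>i\<le>m. \<Sum>l | l \<in> {..m} \<and> i \<le> l. ?f l i)"
      by (rule sum.swap_restrict) auto
    moreover have "{i. i \<in> {..m} \<and> i \<le> l} = {..l}" if "l \<in> {..m}" for l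
      using that by auto
    moreover have "{l. l \<in> {..m} \<and> i \<le> l} = {i..m}" for i
      by auto
    ultimately show ?thesis by simp
  qed
  also have "\<dots> = (\<Sum>i\<le>m. of_nat (m choose i) * A ^ i * d i)"
  proof (rule sum.cong)
    fix i assume "i \<in> {..m}"
    then have i: "i \<le> m" by simp
    have "(\<Sum>l=i..m. ?f l i) = (\<Sum>j\<le>m - i. ?f (j + i) i)"
      using sum.shift_bounds_cl_nat_ivl[of "\<lambda>l. ?f l i" 0 i "m - i"] i by (simp add: atLeast0AtMost)
    also have "\<dots> = (\<Sum>j\<le>m - i. of_nat (m choose i) * A ^ i * d i * (of_nat (m - i choose j) * A ^ j * (1 - A) ^ (m - i - j)))"
    proof (rule sum.cong)
      fix j assume "j \<in> {..m - i}"
      then have "(m choose (j + i)) * ((j + i) choose i) = (m choose i) * (m - i choose j)"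
        using choose_mult[of i "j + i" m] i by simp
      then have "of_nat (m choose (j + i)) * of_nat ((j + i) choose i) =
          (of_nat (m choose i) * of_nat (m - i choose j) :: 'a)"
        by (metis of_nat_mult)
      moreover have "?f (j + i) i = (of_nat (m choose (j + i)) * of_nat ((j + i) choose i)) *
          (A ^ i * d i * (A ^ j * (1 - A) ^ (m - i - j)))"
        by (simp add: power_add ac_simps diff_diff_left)
      ultimately show "?f (j + i) i = of_nat (m choose i) * A ^ i * d i *
          (of_nat (m - i choose j) * A ^ j * (1 - A) ^ (m - i - j))"
        by (simp only: ac_simps)
    qed auto
    also have "\<dots> = of_nat (m choose i) * A ^ i * d i * (A + (1 - A)) ^ (m - i)"
      by (simp only: binomial_ring sum_distrib_left)
    finally show "(\<Sum>l=i..m. ?f l i) = of_nat (m choose i) * A ^ i * d i" by simp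
  qed auto
  finally show ?thesis .
qed

text \<open>The sum is the derivative of x (1 - x)^r at x = 1. The exceptional value at
  \<open>r = 1\<close> produces the right-hand side of the Carlitz recursion.\<close>

lemma alternating_choose_sum:
  "(\<Sum>l\<le>r. of_nat (r choose l) * (- 1) ^ l * of_nat (Suc l)) =
    (if r = 0 then 1 else if r = 1 then - 1 else (0::'a::comm_ring_1))"
proof (cases "r \<le> 1")
  case True
  then have "r = 0 \<or> r = 1" by auto
  then show ?thesis by auto
next
  case False
  have "(\<Sum>l\<le>r. of_nat (r choose l) * (- 1) ^ l * of_nat (Suc l)) =
      (\<Sum>l\<le>r. (- 1) ^ l * of_nat l * of_nat (r choose l)) + (\<Sum>l\<le>r. (- 1) ^ l * (of_nat (r choose l) :: 'a))"
    by (simp add: sum.distrib[symmetric] algebra_simps)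
  then show ?thesis
    using False choose_alternating_sum[of r, where 'a='a] choose_alternating_linear_sum[of r, where 'a='a] by simp
qed

text \<open>This is (-1)^l (l + 1)/[l + 1]_Q, whose binomial transform is (1 - Q)^r times the
  \<open>r\<close>-th Carlitz number.\<close>

definition carlitz_coeff :: "'a::field_char_0 \<Rightarrow> nat \<Rightarrow> 'a" where
  "carlitz_coeff Q l = (- 1) ^ l * (of_nat (Suc l) * (1 - Q) / (1 - Q ^ Suc l))"

text \<open>The closed form satisfies the recursion, whose solution is unique.\<close>

lemma carlitz_number_eq:
  fixes Q :: "'a::field_char_0"
  assumes nz: "\<And>r. r \<ge> 1 \<Longrightarrow> Q ^ r \<noteq> 1"
  shows "carlitz_number Q r = (\<Sum>l\<le>r. of_nat (r choose l) * carlitz_coeff Q l) / (1 - Q) ^ r"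
proof -
  have Q: "1 - Q \<noteq> 0" using nz[of 1] by simp
  define b where "b r = (\<Sum>l\<le>r. of_nat (r choose l) * carlitz_coeff Q l) / (1 - Q) ^ r" for r
  have "carlitz_recursion Q b"
    unfolding carlitz_recursion_def
  proof (intro conjI allI impI)
    show "b 0 = 1" using Q by (simp add: b_def carlitz_coeff_def)
  next
    fix r :: nat assume r: "r \<ge> 1"
    let ?c = "carlitz_coeff Q"
    have "(\<Sum>l\<le>r. of_nat (r choose l) * Q ^ l * b l) =
        (\<Sum>l\<le>r. of_nat (r choose l) * Q ^ l * (1 - Q) ^ (r - l) * (\<Sum>i\<le>l. of_nat (l choose i) * ?c i)) / (1 - Q) ^ r"
      unfolding sum_divide_distrib
    proof (rule sum.cong)
      fix l assume "l \<in> {..r}"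
      then have "(1 - Q) ^ r = (1 - Q) ^ (r - l) * (1 - Q) ^ l"
        by (simp add: power_add[symmetric])
      then show "of_nat (r choose l) * Q ^ l * b l =
        of_nat (r choose l) * Q ^ l * (1 - Q) ^ (r - l) * (\<Sum>i\<le>l. of_nat (l choose i) * ?c i) / (1 - Q) ^ r"
        using Q by (simp add: b_def)
    qed auto
    also have "\<dots> = (\<Sum>l\<le>r. of_nat (r choose l) * Q ^ l * ?c l) / (1 - Q) ^ r"
      by (simp add: sum_choose_mult_choose)
    finally have "Q * (\<Sum>l\<le>r. of_nat (r choose l) * Q ^ l * b l) - b r =
        (\<Sum>l\<le>r. of_nat (r choose l) * (Q ^ Suc l - 1) * ?c l) / (1 - Q) ^ r"
      by (simp add: b_def sum_distrib_left diff_divide_distrib[symmetric] sum_subtractf[symmetric] algebra_simps)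
    \<comment> \<open>The factor \<open>Q ^ Suc l - 1\<close> cancels the denominator of the
      coefficient up to sign, leaving an alternating sum free of \<open>Q\<close>.\<close>
    also have "(\<Sum>l\<le>r. of_nat (r choose l) * (Q ^ Suc l - 1) * ?c l) =
        - (1 - Q) * (\<Sum>l\<le>r. of_nat (r choose l) * (- 1) ^ l * of_nat (Suc l))"
      unfolding sum_distrib_left
    proof (rule sum.cong)
      fix l
      have "1 - Q ^ Suc l \<noteq> 0" using nz[of "Suc l"] by (simp del: power_Suc)
      then have "(Q ^ Suc l - 1) * ?c l = - ((- 1) ^ l * of_nat (Suc l) * (1 - Q))"
        by (simp add: carlitz_coeff_def field_simps del: power_Suc of_nat_Suc)
      then show "of_nat (r choose l) * (Q ^ Suc l - 1) * ?c l =
          - (1 - Q) * (of_nat (r choose l) * (- 1) ^ l * of_nat (Suc l))"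
        by (simp add: mult.assoc del: power_Suc of_nat_Suc) (simp add: algebra_simps del: power_Suc of_nat_Suc)
    qed auto
    also have "- (1 - Q) * (\<Sum>l\<le>r. of_nat (r choose l) * (- 1) ^ l * of_nat (Suc l)) / (1 - Q) ^ r =
        (if r = 1 then 1 else 0)"
      using r Q by (subst alternating_choose_sum) auto
    finally show "Q * (\<Sum>l\<le>r. of_nat (r choose l) * Q ^ l * b l) - b r = (if r = 1 then 1 else 0)" .
  qed
  moreover have "carlitz_recursion Q (carlitz_number Q)"
    using nz by (intro carlitz_recursion_carlitz_number) (simp del: power_Suc)
  ultimately have "carlitz_number Q = b"
    using carlitz_recursion_ex1[of Q] nz by (metis le_SucI)
  then show ?thesis by (simp add: b_def)
qed

text \<open>The denominators of [a]_Q^(m - l) and of the \<open>l\<close>-th Carlitz number combine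
  to (1 - Q)^m; the double sum then collapses.\<close>

lemma carlitz_poly_eq:
  fixes Q :: "'a::ultrametric_field"
  assumes nz: "\<And>r. r \<ge> 1 \<Longrightarrow> Q ^ r \<noteq> 1"
  shows "carlitz_poly m Q a =
    (\<Sum>l\<le>m. of_nat (m choose l) * padic_power Q a ^ l * carlitz_coeff Q l) / (1 - Q) ^ m"
proof -
  have Q: "1 - Q \<noteq> 0" using nz[of 1] by simp
  let ?A = "padic_power Q a"
  have "carlitz_poly m Q a =
      (\<Sum>l\<le>m. of_nat (m choose l) * ?A ^ l * (1 - ?A) ^ (m - l) *
        (\<Sum>i\<le>l. of_nat (l choose i) * carlitz_coeff Q i)) / (1 - Q) ^ m"
    unfolding carlitz_poly_def sum_divide_distrib
  proof (rule sum.cong)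
    fix l assume "l \<in> {..m}"
    then have "(1 - Q) ^ m = (1 - Q) ^ (m - l) * (1 - Q) ^ l"
      by (simp add: power_add[symmetric])
    then show "of_nat (m choose l) * ?A ^ l * q_number Q a ^ (m - l) * carlitz_number Q l =
        of_nat (m choose l) * ?A ^ l * (1 - ?A) ^ (m - l) *
          (\<Sum>i\<le>l. of_nat (l choose i) * carlitz_coeff Q i) / (1 - Q) ^ m"
      by (simp add: carlitz_number_eq[OF nz] q_number_def power_divide)
  qed auto
  then show ?thesis
    by (simp add: sum_choose_mult_choose)
qed

lemma sum_PiE_power_prod:
  fixes y :: "'a::field"
  assumes "finite I" and "\<And>j. j \<in> I \<Longrightarrow> y ^ c j \<noteq> 1"
  shows "(\<Sum>k \<in> (\<Pi>\<^sub>E j\<in>I. {0..<v j}). y ^ (\<Sum>j\<in>I. c j * k j)) =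
    (\<Prod>j\<in>I. (1 - y ^ (c j * v j)) / (1 - y ^ c j))"
proof -
  have "(\<Sum>k \<in> (\<Pi>\<^sub>E j\<in>I. {0..<v j}). y ^ (\<Sum>j\<in>I. c j * k j)) =
      (\<Sum>k \<in> (\<Pi>\<^sub>E j\<in>I. {0..<v j}). \<Prod>j\<in>I. (y ^ c j) ^ k j)"
    by (simp add: power_sum power_mult)
  also have "\<dots> = (\<Prod>j\<in>I. \<Sum>i\<in>{0..<v j}. (y ^ c j) ^ i)"
    using assms(1) by (rule prod_sum_PiE[symmetric]) simp
  also have "\<dots> = (\<Prod>j\<in>I. (1 - y ^ (c j * v j)) / (1 - y ^ c j))"
    using assms(2) by (intro prod.cong) (auto simp: atLeast0LessThan sum_gp_strict power_mult)
  finally show ?thesis .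
qed


subsection \<open>Symmetry\<close>

context padic_abs_val
begin

lemma abs_val_mult_log_less:
  assumes "abs_val (t::'a) < conv_radius" and "abs_val a \<le> 1"
  shows "abs_val (a * padic_log (1 + t)) < conv_radius"
  using mult_mono[OF assms(2) abs_val_padic_log_le[OF assms(1)]] assms(1)
  by (simp add: abs_val_mult)

lemma padic_power_of_nat:
  assumes t: "abs_val (t::'a) < conv_radius"
  shows "padic_power (1 + t) (of_nat N) = (1 + t) ^ N"
  using abs_val_mult_log_less[OF t, of 1]
  by (simp add: padic_power_def padic_exp_of_nat_mult padic_exp_log[OF t])

lemma padic_power_add_of_nat:
  assumes t: "abs_val (t::'a) < conv_radius" and a: "abs_val a \<le> 1"
  shows "padic_power (1 + t) (a + of_nat N) = padic_power (1 + t) a * (1 + t) ^ N"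
  using abs_val_mult_log_less[OF t a] abs_val_mult_log_less[OF t abs_val_of_nat_le[of N]]
  unfolding padic_power_of_nat[OF t, symmetric]
  by (simp add: padic_power_def distrib_right padic_exp_add)

text \<open>This moves from base q^W to base \<open>q\<close>. It needs no bound on
  \<open>a\<close>, whose denominators \<open>W\<close> will clear.\<close>

lemma padic_power_power:
  assumes "abs_val (t::'a) < conv_radius"
  shows "padic_power ((1 + t) ^ W) a = padic_power (1 + t) (of_nat W * a)"
  by (simp add: padic_power_def padic_log_power[OF assms] mult_ac)

text \<open>The right-hand side is free of \<open>\<sigma>\<close>, so two instances of it give the
  theorem.\<close>

lemma carlitz_B_eq:
  fixes q x :: 'a and w :: "nat \<Rightarrow> nat"
  assumes q: "abs_val (q - 1) < conv_radius" "q \<noteq> 1" and n: "n \<ge> 1"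
    and w: "\<forall>i\<in>{1..n}. w i \<ge> 1" and x: "abs_val x \<le> 1" and \<sigma>: "\<sigma> permutes {1..n}"
  defines "P \<equiv> \<Prod>i\<in>{1..n}. w i"
  shows "carlitz_B m n w q x \<sigma> = (1 - q) powi (1 - int m) *
    (\<Sum>l\<le>m. of_nat (m choose l) * padic_power q (of_nat P * x) ^ l * ((- 1) ^ l * of_nat (Suc l) *
       ((1 - q ^ (Suc l * P)) ^ (n - 1) / (\<Prod>i\<in>{1..n}. 1 - q ^ (Suc l * (P div w i))))))"
proof -
  define t where "t = q - 1"
  have t: "abs_val t < conv_radius" "t \<noteq> 0" and qt: "q = 1 + t"
    using q by (auto simp: t_def)
  have q_power: "q ^ M \<noteq> 1" if "M > 0" for M
    unfolding qt using power_neq_1[OF t that] .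
  define v where "v j = w (\<sigma> j)" for j
  define W where "W = (\<Prod>j\<in>{1..<n}. v j)"
  \<comment> \<open>The coefficient of \<open>k j\<close> in the exponent, equal to
    \<open>P div v j\<close> for \<open>j < n\<close>.\<close>
  define c where "c j = v n * (\<Prod>i\<in>{1..<n} - {j}. v i)" for j
  define N where "N k = (\<Sum>j\<in>{1..<n}. c j * k j)" for k :: "nat \<Rightarrow> nat"
  define X where "X = padic_power q (of_nat P * x)"
  define R where "R l = (1 - q ^ (Suc l * P)) ^ (n - 1) / (\<Prod>i\<in>{1..n}. 1 - q ^ (Suc l * (P div w i)))" for l
  have v: "v j > 0" if "j \<in> {1..n}" for j
    using w permutes_in_image[OF \<sigma>, of j] that by (force simp: v_def)
  have c_pos: "c j > 0" for j
    using v n by (auto simp: c_def intro!: prod_pos)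
  have W_pos: "W > 0"
    using v by (auto simp: W_def intro!: prod_pos)
  have W_eq: "W = v j * (\<Prod>i\<in>{1..<n} - {j}. v i)" if "j \<in> {1..<n}" for j
    using that by (simp add: W_def prod.remove)
  have insert_n: "{1..n} = insert n {1..<n}"
    using n by auto
  have "P = (\<Prod>i\<in>{1..n}. v i)"
    using prod.permute[OF \<sigma>, of w] by (simp add: P_def v_def)
  then have P_eq: "P = v n * W"
    unfolding insert_n W_def by simp
  have c_mult: "c j * v j = P" if "j \<in> {1..<n}" for j
    using W_eq[OF that] by (simp add: P_eq c_def mult_ac)
  have c_eq: "c j = P div v j" if "j \<in> {1..<n}" for j
    using c_mult[OF that] v[of j] that by auto
  have W_div: "W = P div v n"
    using v[of n] n by (simp add: P_eq)

  \<comment> \<open>Multiplication by \<open>W\<close> turns the fractions into the same integer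
    \<open>N k\<close> that occurs in the weight \<open>q ^ N k\<close>.\<close>
  have arg: "of_nat W * (of_nat (v n) * x + of_nat (v n) * (\<Sum>j\<in>{1..<n}. of_nat (k j) / of_nat (v j))) =
      of_nat P * x + (of_nat (N k) :: 'a)" for k
  proof -
    have "of_nat W * (of_nat (v n) * (of_nat (k j) / of_nat (v j))) = (of_nat (c j * k j) :: 'a)"
      if "j \<in> {1..<n}" for j
    proof -
      have "of_nat (v j) \<noteq> (0::'a)" using v[of j] that by simp
      then show ?thesis
        using that by (simp add: W_eq[OF that] c_def field_simps del: of_nat_prod)
    qed
    then have "of_nat W * (of_nat (v n) * (\<Sum>j\<in>{1..<n}. of_nat (k j) / of_nat (v j))) = (of_nat (N k) :: 'a)"
      unfolding N_def of_nat_sum sum_distrib_left by (intro sum.cong refl)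
    then show ?thesis
      by (simp add: distrib_left P_eq mult_ac)
  qed
  have Px: "abs_val (of_nat P * x) \<le> 1"
    using mult_mono[OF abs_val_of_nat_le[of P, where 'a='a] x] by (simp add: abs_val_mult)
  have power_arg: "padic_power (q ^ W) (of_nat (v n) * x + of_nat (v n) * (\<Sum>j\<in>{1..<n}. of_nat (k j) / of_nat (v j))) =
      X * q ^ N k" for k
    unfolding qt padic_power_power[OF t(1)] arg padic_power_add_of_nat[OF t(1) Px] X_def ..
  have q_number_W: "q_number q (of_nat W) = (1 - q ^ W) / (1 - q)"
    unfolding q_number_def qt padic_power_of_nat[OF t(1)] ..
  have exponent: "v n * (\<Sum>j\<in>{1..<n}. (\<Prod>i\<in>{1..<n} - {j}. v i) * k j) = N k" for k
    by (simp add: N_def c_def sum_distrib_left mult.assoc)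

  \<comment> \<open>The denominator of the coefficient is \<open>g (\<sigma> n)\<close>, the one
    factor absent from the geometric sums; its numerator \<open>1 - q ^ W\<close> is kept outside
    \<open>R l\<close>.\<close>
  have inner: "carlitz_coeff (q ^ W) l * (\<Sum>k \<in> (\<Pi>\<^sub>E j\<in>{1..<n}. {0..<v j}). (q ^ Suc l) ^ N k) =
      (1 - q ^ W) * ((- 1) ^ l * of_nat (Suc l) * R l)" for l
  proof -
    define g where "g i = 1 - q ^ (Suc l * (P div w i))" for i
    have g_W: "g (\<sigma> n) = 1 - (q ^ W) ^ Suc l"
      unfolding g_def W_div v_def power_mult[symmetric] by (simp add: mult.commute)
    have "(\<Sum>k \<in> (\<Pi>\<^sub>E j\<in>{1..<n}. {0..<v j}). (q ^ Suc l) ^ N k) =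
        (\<Prod>j\<in>{1..<n}. (1 - (q ^ Suc l) ^ (c j * v j)) / (1 - (q ^ Suc l) ^ c j))"
      unfolding N_def
    proof (rule sum_PiE_power_prod)
      show "(q ^ Suc l) ^ c j \<noteq> 1" for j
        unfolding power_mult[symmetric] using c_pos[of j] by (intro q_power) simp
    qed auto
    also have "\<dots> = (\<Prod>j\<in>{1..<n}. (1 - q ^ (Suc l * P)) / g (\<sigma> j))"
    proof (rule prod.cong)
      fix j assume j: "j \<in> {1..<n}"
      show "(1 - (q ^ Suc l) ^ (c j * v j)) / (1 - (q ^ Suc l) ^ c j) = (1 - q ^ (Suc l * P)) / g (\<sigma> j)"
        unfolding c_mult[OF j] power_mult[symmetric] unfolding c_eq[OF j] g_def v_def ..
    qed auto
    also have "\<dots> = (1 - q ^ (Suc l * P)) ^ (n - 1) / (\<Prod>j\<in>{1..<n}. g (\<sigma> j))"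
      by (simp add: prod_dividef)
    finally have S: "(\<Sum>k \<in> (\<Pi>\<^sub>E j\<in>{1..<n}. {0..<v j}). (q ^ Suc l) ^ N k) = \<dots>" .
    have "(\<Prod>i\<in>{1..n}. g i) = (\<Prod>j\<in>{1..n}. g (\<sigma> j))"
      using prod.permute[OF \<sigma>, of g] by (simp add: o_def)
    also have "\<dots> = g (\<sigma> n) * (\<Prod>j\<in>{1..<n}. g (\<sigma> j))"
      unfolding insert_n by simp
    finally have R: "R l = (1 - q ^ (Suc l * P)) ^ (n - 1) / (g (\<sigma> n) * (\<Prod>j\<in>{1..<n}. g (\<sigma> j)))"
      unfolding R_def g_def[symmetric] by simp
    show ?thesis
      unfolding S R carlitz_coeff_def g_W by (simp del: power_Suc of_nat_Suc)
  qed

  have nzW: "(q ^ W) ^ r \<noteq> 1" if "r \<ge> 1" for r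
    unfolding power_mult[symmetric] using W_pos that by (intro q_power) simp
  have "carlitz_B m n w q x \<sigma> = q_number q (of_nat W) powi (int m - 1) *
      (\<Sum>k \<in> (\<Pi>\<^sub>E j\<in>{1..<n}. {0..<v j}). q ^ N k *
        ((\<Sum>l\<le>m. of_nat (m choose l) * (X * q ^ N k) ^ l * carlitz_coeff (q ^ W) l) / (1 - q ^ W) ^ m))"
    unfolding carlitz_B_def v_def[symmetric] W_def[symmetric] exponent
    by (simp only: carlitz_poly_eq[OF nzW] power_arg)
  \<comment> \<open>The weight supplies one more power: q^N (q^N)^l = (q^(l + 1))^N.\<close>
  also have "(\<Sum>k \<in> (\<Pi>\<^sub>E j\<in>{1..<n}. {0..<v j}). q ^ N k *
        ((\<Sum>l\<le>m. of_nat (m choose l) * (X * q ^ N k) ^ l * carlitz_coeff (q ^ W) l) / (1 - q ^ W) ^ m)) =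
      (\<Sum>k \<in> (\<Pi>\<^sub>E j\<in>{1..<n}. {0..<v j}). \<Sum>l\<le>m. of_nat (m choose l) * X ^ l *
         (carlitz_coeff (q ^ W) l * (q ^ Suc l) ^ N k)) / (1 - q ^ W) ^ m"
    unfolding sum_divide_distrib sum_distrib_left
    by (intro sum.cong refl)
      (simp add: power_mult_distrib power_commutes power_mult[symmetric] power_add[symmetric] mult_ac)
  also have "\<dots> = (\<Sum>l\<le>m. of_nat (m choose l) * X ^ l * (carlitz_coeff (q ^ W) l *
         (\<Sum>k \<in> (\<Pi>\<^sub>E j\<in>{1..<n}. {0..<v j}). (q ^ Suc l) ^ N k))) / (1 - q ^ W) ^ m"
    by (subst sum.swap) (simp only: sum_distrib_left)
  also have "\<dots> = (1 - q ^ W) / (1 - q ^ W) ^ m *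
      (\<Sum>l\<le>m. of_nat (m choose l) * X ^ l * ((- 1) ^ l * of_nat (Suc l) * R l))"
    unfolding inner by (simp add: sum_distrib_left sum_divide_distrib mult_ac)
  finally have "carlitz_B m n w q x \<sigma> =
      (q_number q (of_nat W) powi (int m - 1) * ((1 - q ^ W) / (1 - q ^ W) ^ m)) *
      (\<Sum>l\<le>m. of_nat (m choose l) * X ^ l * ((- 1) ^ l * of_nat (Suc l) * R l))"
    by (simp only: mult.assoc)
  \<comment> \<open>The powers of \<open>1 - q ^ W\<close> cancel, also for \<open>m = 0\<close>,
    where the outer exponent is -1.\<close>
  also have "q_number q (of_nat W) powi (int m - 1) * ((1 - q ^ W) / (1 - q ^ W) ^ m) = (1 - q) powi (1 - int m)"
    using q_power[OF W_pos] q(2)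
    by (simp add: q_number_W power_int_divide_distrib power_int_diff field_simps)
  finally show ?thesis
    unfolding X_def R_def .
qed

end

theorem theorem2p2:
  fixes p m n :: nat
    and q x :: "'a::ultrametric_field"
    and w \<sigma> \<tau> :: "nat \<Rightarrow> nat"
  assumes "prime p"
    and "padic_complex_field p TYPE('a)"
    and "q \<noteq> 1"
    and "abs_val (1 - q) < real p powr (- 1 / (real p - 1))"
    and "n \<ge> 1"
    and "\<forall>i\<in>{1..n}. w i \<ge> 1"
    and "x \<in> padic_integers"
    and "\<sigma> permutes {1..n}"
    and "\<tau> permutes {1..n}"
  shows "carlitz_B m n w q x \<sigma> = carlitz_B m n w q x \<tau>"
proof -
  interpret padic_abs_val p "TYPE('a)"
    using assms(1,2) by unfold_locales (auto simp: padic_complex_field_def)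
  have "abs_val (q - 1) < conv_radius"
    using assms(4) by (simp add: conv_radius_def abs_val_minus_commute)
  moreover have "abs_val x \<le> 1"
    using assms(7) by (simp add: padic_integers_def)
  ultimately show ?thesis
    using carlitz_B_eq[of q n w x \<sigma> m] carlitz_B_eq[of q n w x \<tau> m] assms by simp
qed

end
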